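(* For every integer $q\ge3$, $\mathcal{T}^2_q\subsetneq\mathcal{TW}_1\cap\mathcal{TD}_q$; and for all integers $k,q\ge1$ with $2\le k-1\le\frac{q-4}{1+\log q}$, $\mathcal{T}^k_q\subsetneq\mathcal{TW}_{k-1}\cap\mathcal{TD}_q$.
   Context: All graphs are finite, simple and loopless; $\log$ is base 2. A rooted forest on $V$ induces an ancestor order $\preceq$; its depth is the maximum number of vertices on a root-to-leaf path. A $k$-pebble forest cover of $G$ is a rooted forest on $V(G)$ with a map $p\colon V(G)\to\{1,\dots,k\}$ such that every edge joins $\preceq$-comparable vertices and if $uv\in E(G)$, $u\prec v$, then $p(u)\ne p(w)$ for all $w$ with $u\prec w\preceq v$. $\mathcal{T}^k_q$ is the class of graphs admitting a $k$-pebble forest cover of depth at most $q$. $\mathcal{TW}_{k-1}$ is the class of graphs of treewidth at most $k-1$; $\mathcal{TD}_q$ is the class of graphs of treedepth at most $q$ (minimum depth of a rooted forest on $V(G)$ in which every edge joins $\preceq$-comparable vertices). *)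

theory Defs
  imports Complex_Main "HOL-Library.FuncSet" "Graph_Theory.Graph_Theory"
begin

text \<open>
  A finite simple graph is a digraph satisfying \<^locale>\<open>pair_graph\<close>: an undirected edge between
  \<open>u\<close> and \<open>v\<close> is the pair of arcs \<open>(u, v)\<close>, \<open>(v, u)\<close>. The empty graph is allowed.
\<close>

subsection \<open>Rooted forests\<close>

text \<open>
  A rooted forest on \<open>V\<close> is given by its arcs from parents to children. The ancestor order
  (an ancestor is below its descendants) is \<open>(u, v) \<in> F\<^sup>*\<close>, its strict part \<open>(u, v) \<in> F\<^sup>+\<close>.
\<close>

definition rooted_forest :: "'a set \<Rightarrow> 'a rel \<Rightarrow> bool" where
  "rooted_forest V F \<longleftrightarrow> finite V \<and> F \<subseteq> V \<times> V \<and> single_valued (F\<inverse>) \<and> acyclic F"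

definition root_leaf_path :: "'a set \<Rightarrow> 'a rel \<Rightarrow> 'a list \<Rightarrow> bool" where
  "root_leaf_path V F xs \<longleftrightarrow>
     xs \<noteq> [] \<and> set xs \<subseteq> V \<and> successively (\<lambda>u v. (u, v) \<in> F) xs \<and>
     (\<nexists>u. (u, hd xs) \<in> F) \<and> (\<nexists>v. (last xs, v) \<in> F)"

text \<open>Since \<open>Sup {} = 0\<close> on the natural numbers, the empty forest has depth 0.\<close>

definition forest_depth :: "'a set \<Rightarrow> 'a rel \<Rightarrow> nat" where
  "forest_depth V F = Sup {length xs |xs. root_leaf_path V F xs}"

subsection \<open>Treedepth and pebble forest covers\<close>

definition forest_cover :: "'a pair_pre_digraph \<Rightarrow> 'a rel \<Rightarrow> bool" where
  "forest_cover G F \<longleftrightarrow>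
     rooted_forest (pverts G) F \<and>
     (\<forall>(u, v) \<in> parcs G. (u, v) \<in> F\<^sup>* \<or> (v, u) \<in> F\<^sup>*)"

definition treedepth :: "'a pair_pre_digraph \<Rightarrow> nat" where
  "treedepth G = Inf {forest_depth (pverts G) F |F. forest_cover G F}"

definition pebble_forest_cover ::
    "nat \<Rightarrow> 'a pair_pre_digraph \<Rightarrow> 'a rel \<Rightarrow> ('a \<Rightarrow> nat) \<Rightarrow> bool" where
  "pebble_forest_cover k G F p \<longleftrightarrow>
     forest_cover G F \<and> p \<in> pverts G \<rightarrow> {1..k} \<and>
     (\<forall>u v. (u, v) \<in> parcs G \<and> (u, v) \<in> F\<^sup>+ \<longrightarrow>
        (\<forall>w. (u, w) \<in> F\<^sup>+ \<and> (w, v) \<in> F\<^sup>* \<longrightarrow> p u \<noteq> p w))"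

subsection \<open>Treewidth\<close>

text \<open>
  The constant \<^const>\<open>tree\<close> of the graph library cannot be used: \<^const>\<open>forest\<close> forbids directed
  cycles of every positive length, so no symmetric digraph with an arc is a \<^const>\<open>forest\<close>. In a
  loopless symmetric digraph the cycles of length at least 3 are the undirected cycles.
\<close>

definition undirected_tree :: "'a pair_pre_digraph \<Rightarrow> bool" where
  "undirected_tree T \<longleftrightarrow>
     pair_graph T \<and> Digraph_Component.connected T \<and> (\<nexists>c. pre_digraph.cycle T c \<and> 3 \<le> length c)"

text \<open>Every finite tree is isomorphic to one whose nodes are natural numbers.\<close>

definition tree_decomposition ::
    "'a pair_pre_digraph \<Rightarrow> nat pair_pre_digraph \<Rightarrow> (nat \<Rightarrow> 'a set) \<Rightarrow> bool" where
  "tree_decomposition G T B \<longleftrightarrow>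
     undirected_tree T \<and>
     (\<Union>t \<in> pverts T. B t) = pverts G \<and>
     (\<forall>(u, v) \<in> parcs G. \<exists>t \<in> pverts T. u \<in> B t \<and> v \<in> B t) \<and>
     (\<forall>v \<in> pverts G. Digraph_Component.connected (T \<restriction> {t \<in> pverts T. v \<in> B t}))"

text \<open>
  The truncated subtraction only matters for the empty graph, to which it assigns treewidth 0
  instead of -1.
\<close>

definition decomposition_width :: "nat pair_pre_digraph \<Rightarrow> (nat \<Rightarrow> 'a set) \<Rightarrow> nat" where
  "decomposition_width T B = Max ((\<lambda>t. card (B t)) ` pverts T) - 1"

definition treewidth :: "'a pair_pre_digraph \<Rightarrow> nat" where
  "treewidth G = Inf {decomposition_width T B |T B. tree_decomposition G T B}"

subsection \<open>The graph classes\<close>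

text \<open>
  The classes are isomorphism invariant, and a copy of every finite graph lives on any infinite
  vertex type \<open>'a\<close>; over a finite \<open>'a\<close> strict inclusions could fail for lack of vertices.
\<close>

definition pebble_class :: "nat \<Rightarrow> nat \<Rightarrow> 'a pair_pre_digraph set" where
  "pebble_class k q =
     {G. pair_graph G \<and>
         (\<exists>F p. pebble_forest_cover k G F p \<and> forest_depth (pverts G) F \<le> q)}"

definition treewidth_class :: "nat \<Rightarrow> 'a pair_pre_digraph set" where
  "treewidth_class w = {G. pair_graph G \<and> treewidth G \<le> w}"

definition treedepth_class :: "nat \<Rightarrow> 'a pair_pre_digraph set" where
  "treedepth_class q = {G. pair_graph G \<and> treedepth G \<le> q}"

text \<open>
  Every finite graph has a forest cover and a tree decomposition, so the infima in
  \<^const>\<open>treedepth\<close> and \<^const>\<open>treewidth\<close> are attained minima.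
\<close>

lemma ex_forest_cover:
  assumes "pair_graph G"
  shows "\<exists>F. forest_cover G F"
proof -
  interpret pair_graph G by fact
  obtain f :: "'a \<Rightarrow> nat" and n where inj: "inj_on f (pverts G)" and im: "f ` pverts G = {i. i < n}"
    using finite_imp_inj_to_nat_seg[OF pair_finite_verts] by metis
  define F where "F = {(u, v). u \<in> pverts G \<and> v \<in> pverts G \<and> f v = Suc (f u)}"
  have "(u, v) \<in> F\<^sup>*" if "u \<in> pverts G" "v \<in> pverts G" "f u + d = f v" for u v d
    using that
  proof (induction d arbitrary: v)
    case 0
    then show ?case using inj by (auto dest: inj_onD)
  next
    case (Suc d)
    have "f v < n" using im Suc.prems(2) by blast
    with Suc.prems(3) have "f u + d \<in> {i. i < n}" by simp
    then obtain w where w: "w \<in> pverts G" "f u + d = f w" using im by (metis imageE)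
    then have "(w, v) \<in> F" using Suc.prems by (auto simp: F_def)
    with Suc.IH[OF Suc.prems(1) w] show ?case by simp
  qed
  then have comp: "(u, v) \<in> F\<^sup>* \<or> (v, u) \<in> F\<^sup>*" if "u \<in> pverts G" "v \<in> pverts G" for u v
    using that by (metis le_add_diff_inverse nat_le_linear)
  have "F \<subseteq> measure f" by (auto simp: F_def)
  then have "acyclic F" by (meson wf_acyclic wf_measure wf_subset)
  then have "rooted_forest (pverts G) F"
    using inj pair_finite_verts
    by (auto simp: rooted_forest_def F_def single_valued_def dest: inj_onD)
  then show ?thesis
    using comp in_arcsD1 in_arcsD2 unfolding forest_cover_def by blast
qed

lemma treedepth_le_iff:
  assumes "pair_graph G"
  shows "treedepth G \<le> q \<longleftrightarrow> (\<exists>F. forest_cover G F \<and> forest_depth (pverts G) F \<le> q)"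
proof
  assume "treedepth G \<le> q"
  moreover have "treedepth G \<in> {forest_depth (pverts G) F |F. forest_cover G F}"
    unfolding treedepth_def using ex_forest_cover[OF assms] by (intro Inf_nat_def1) auto
  ultimately show "\<exists>F. forest_cover G F \<and> forest_depth (pverts G) F \<le> q" by auto
next
  assume "\<exists>F. forest_cover G F \<and> forest_depth (pverts G) F \<le> q"
  then obtain F where "forest_cover G F" "forest_depth (pverts G) F \<le> q" by blast
  moreover from this have "treedepth G \<le> forest_depth (pverts G) F"
    unfolding treedepth_def by (intro cInf_lower) auto
  ultimately show "treedepth G \<le> q" by simp
qed

lemma ex_tree_decomposition:
  assumes "pair_graph G"
  shows "\<exists>T B. tree_decomposition G T B"
proof -
  interpret pair_graph G by fact
  define T :: "nat pair_pre_digraph" where "T = \<lparr>pverts = {0}, parcs = {}\<rparr>"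
  have T: "pair_graph T"
    by unfold_locales (auto simp: T_def symmetric_def sym_def)
  then interpret T: pair_graph T .
  have conn: "Digraph_Component.connected T" "Digraph_Component.connected (T \<restriction> {0})"
    by (auto simp: connected_def strongly_connected_def mk_symmetric_def T_def
          reachable_def intro: rtrancl_on_refl)
  have "\<not> pre_digraph.cycle T c" for c
    by (cases c) (auto simp: pre_digraph.cycle_def pre_digraph.awalk_def T_def)
  with T conn have "undirected_tree T" by (simp add: undirected_tree_def)
  moreover have "{t \<in> pverts T. v \<in> pverts G} = {0}" if "v \<in> pverts G" for v
    using that by (auto simp: T_def)
  ultimately have "tree_decomposition G T (\<lambda>_. pverts G)"
    using conn in_arcsD1 in_arcsD2 by (auto simp: tree_decomposition_def T_def)
  then show ?thesis by blast
qed

lemma treewidth_le_iff: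
  assumes "pair_graph G"
  shows "treewidth G \<le> w \<longleftrightarrow>
    (\<exists>T B. tree_decomposition G T B \<and> decomposition_width T B \<le> w)"
proof
  assume "treewidth G \<le> w"
  moreover have "treewidth G \<in> {decomposition_width T B |T B. tree_decomposition G T B}"
    unfolding treewidth_def using ex_tree_decomposition[OF assms] by (intro Inf_nat_def1) auto
  ultimately show "\<exists>T B. tree_decomposition G T B \<and> decomposition_width T B \<le> w"
    by (smt (verit, best) mem_Collect_eq)
next
  assume "\<exists>T B. tree_decomposition G T B \<and> decomposition_width T B \<le> w"
  then obtain T B where "tree_decomposition G T B" "decomposition_width T B \<le> w" by blast
  moreover from this have "treewidth G \<le> decomposition_width T B"
    unfolding treewidth_def by (intro cInf_lower) auto
  ultimately show "treewidth G \<le> w" by simp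
qed

end

theory Submission
  imports Defs
begin

text \<open>
  The inclusions: the nodes of the forest, with an additional root, carry a tree decomposition whose
  bag at \<open>v\<close> consists of the last vertex of each pebble on the path to \<open>v\<close>.

  Strictness, with \<open>w = k - 1\<close>: take the \<open>w\<close>-th power of the path on \<open>2q\<close> vertices. Removing \<open>w\<close>
  consecutive vertices in the middle, recursively, shows that its treedepth is about \<open>w log q\<close>. In a
  cover with \<open>w + 1\<close> pebbles every vertex has at most \<open>w\<close> neighbours among its ancestors, because
  these and the vertex itself have distinct pebbles. So the ancestor order has no local maximum in the
  interior of the path: it descends and then ascends, and one of the two branches has more than \<open>q\<close>
  vertices.
\<close>

subsection \<open>Rooted forests\<close>

lemma rooted_forest_wf:
  assumes "rooted_forest V F"
  shows "wf F" "wf (F\<inverse>)"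
proof -
  have "finite F" "acyclic F"
    using assms by (auto simp: rooted_forest_def intro: finite_subset)
  then show "wf F" "wf (F\<inverse>)"
    by (auto intro: finite_acyclic_wf finite_acyclic_wf_converse)
qed

lemma rooted_forest_irrefl: "rooted_forest V F \<Longrightarrow> (v, v) \<notin> F\<^sup>+"
  by (auto simp: rooted_forest_def acyclic_def)

text \<open>Parents are unique, so the walks from \<open>x\<close> up to \<open>u\<close> and to
  \<open>v\<close> follow the same route and one is an initial part of the other. This is confluence
  of the single-valued converse of \<open>F\<close>.\<close>

lemma rooted_forest_ancestors_comparable:
  assumes "rooted_forest V F" "(u, x) \<in> F\<^sup>*" "(v, x) \<in> F\<^sup>*"
  shows "(u, v) \<in> F\<^sup>* \<or> (v, u) \<in> F\<^sup>*"
proof -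
  have "single_valued (F\<inverse>)" "(x, u) \<in> (F\<inverse>)\<^sup>*" "(x, v) \<in> (F\<inverse>)\<^sup>*"
    using assms by (simp_all add: rooted_forest_def rtrancl_converse)
  from single_valued_confluent[OF this] show ?thesis
    by (auto simp: rtrancl_converse)
qed

lemma rooted_forest_trancl_in:
  assumes "rooted_forest V F" "(u, v) \<in> F\<^sup>+"
  shows "u \<in> V" "v \<in> V"
  using assms trancl_subset_Sigma[of F V] by (auto simp: rooted_forest_def)

text \<open>The path to \<open>v\<close> extends the path to its parent; as the parent is unique,
  every other ancestor of \<open>v\<close> is already on that path.\<close>

lemma ex_ancestor_path:
  assumes F: "rooted_forest V F" and "v \<in> V"
  shows "\<exists>xs. xs \<noteq> [] \<and> last xs = v \<and> set xs \<subseteq> V \<and> successively (\<lambda>u v. (u, v) \<in> F) xs \<and>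
    {u. (u, v) \<in> F\<^sup>*} \<subseteq> set xs"
  using \<open>v \<in> V\<close>
proof (induction v rule: wf_induct_rule[OF rooted_forest_wf(1)[OF F]])
  case (1 v)
  show ?case
  proof (cases "\<exists>u. (u, v) \<in> F")
    case True
    then obtain u where u: "(u, v) \<in> F" by blast
    then have "u \<in> V" using F by (auto simp: rooted_forest_def)
    from 1(1)[OF u this] obtain xs where xs: "xs \<noteq> []" "last xs = u" "set xs \<subseteq> V"
      "successively (\<lambda>u v. (u, v) \<in> F) xs" "{x. (x, u) \<in> F\<^sup>*} \<subseteq> set xs" by blast
    have "(x, u) \<in> F\<^sup>*" if "(x, v) \<in> F\<^sup>*" "x \<noteq> v" for x
    proof -
      from that obtain y where y: "(x, y) \<in> F\<^sup>*" "(y, v) \<in> F" by (meson rtranclE)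
      moreover have "single_valued (F\<inverse>)" using F by (simp add: rooted_forest_def)
      ultimately have "y = u" using u by (meson single_valuedD converse_iff)
      then show ?thesis using y by simp
    qed
    then show ?thesis using xs u 1(2)
      by (intro exI[of _ "xs @ [v]"]) (auto simp: successively_append_iff)
  next
    case False
    then have "x = v" if "(x, v) \<in> F\<^sup>*" for x using that by (auto elim: rtranclE)
    then show ?thesis using 1(2) by (intro exI[of _ "[v]"]) auto
  qed
qed

section \<open>Depth of a forest in terms of paths, chains and levels\<close>

lemma rooted_forest_path_length:
  assumes "rooted_forest V F" "set xs \<subseteq> V" "successively (\<lambda>u v. (u, v) \<in> F) xs"
  shows "length xs \<le> card V"
proof -
  have "successively (\<lambda>u v. (u, v) \<in> F\<^sup>+) xs"
    using assms(3) by (rule successively_mono) auto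
  moreover have "transp (\<lambda>u v. (u, v) \<in> F\<^sup>+)" by (auto intro!: transpI)
  ultimately have "sorted_wrt (\<lambda>u v. (u, v) \<in> F\<^sup>+) xs"
    by (simp add: successively_conv_sorted_wrt)
  then have "distinct xs"
    using rooted_forest_irrefl[OF assms(1)] by (induction xs) auto
  then show ?thesis
    using assms by (metis card_mono distinct_card rooted_forest_def)
qed

text \<open>A path of maximal length runs from a root to a leaf.\<close>

lemma path_length_le_forest_depth:
  assumes F: "rooted_forest V F" and xs: "xs \<noteq> []" "set xs \<subseteq> V"
    "successively (\<lambda>u v. (u, v) \<in> F) xs"
  shows "length xs \<le> forest_depth V F"
proof -
  define P where "P ys \<longleftrightarrow> ys \<noteq> [] \<and> set ys \<subseteq> V \<and> successively (\<lambda>u v. (u, v) \<in> F) ys \<and>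
    length xs \<le> length ys" for ys
  have "length ys < Suc (card V)" if "P ys" for ys
    using that rooted_forest_path_length[OF F] by (auto simp: P_def less_Suc_eq_le)
  moreover have "P xs" using xs by (simp add: P_def)
  ultimately obtain ys where ys: "P ys" and max: "\<And>zs. P zs \<Longrightarrow> length zs \<le> length ys"
    using ex_has_greatest_nat[of P xs length] by blast
  have "root_leaf_path V F ys"
    unfolding root_leaf_path_def
  proof (intro conjI)
    show "\<nexists>u. (u, hd ys) \<in> F"
    proof
      assume "\<exists>u. (u, hd ys) \<in> F"
      then obtain u where "(u, hd ys) \<in> F" by blast
      then have "P (u # ys)"
        using ys F by (auto simp: P_def rooted_forest_def successively_Cons)
      then show False using max by fastforce
    qed
    show "\<nexists>u. (last ys, u) \<in> F"
    proof
      assume "\<exists>u. (last ys, u) \<in> F"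
      then obtain u where "(last ys, u) \<in> F" by blast
      then have "P (ys @ [u])"
        using ys F by (auto simp: P_def rooted_forest_def successively_append_iff)
      then show False using max by fastforce
    qed
  qed (use ys in \<open>auto simp: P_def\<close>)
  moreover have "bdd_above {length xs |xs. root_leaf_path V F xs}"
    using rooted_forest_path_length[OF F]
    by (intro bdd_aboveI[of _ "card V"]) (auto simp: root_leaf_path_def)
  ultimately have "length ys \<le> forest_depth V F"
    unfolding forest_depth_def by (intro cSup_upper) auto
  then show ?thesis using ys by (simp add: P_def)
qed

text \<open>All members of a chain are ancestors of its deepest member, hence lie on one path ending
  there.\<close>

lemma card_chain_le_forest_depth:
  assumes F: "rooted_forest V F" and "X \<subseteq> V"
    and chain: "\<And>u v. u \<in> X \<Longrightarrow> v \<in> X \<Longrightarrow> (u, v) \<in> F\<^sup>* \<or> (v, u) \<in> F\<^sup>*"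
  shows "card X \<le> forest_depth V F"
proof (cases "X = {}")
  case False
  then obtain x where "x \<in> X" by blast
  have "wf ((F\<^sup>+)\<inverse>)" using rooted_forest_wf(2)[OF F] wf_trancl by (metis trancl_converse)
  then obtain m where m: "m \<in> X" "\<And>y. (m, y) \<in> F\<^sup>+ \<Longrightarrow> y \<notin> X"
    by (rule wfE_min[OF _ \<open>x \<in> X\<close>]) auto
  then have "m \<in> V" using assms by auto
  from ex_ancestor_path[OF F this] obtain xs where xs: "xs \<noteq> []" "set xs \<subseteq> V"
    "successively (\<lambda>u v. (u, v) \<in> F) xs" "{u. (u, m) \<in> F\<^sup>*} \<subseteq> set xs" by blast
  have "(u, m) \<in> F\<^sup>*" if "u \<in> X" for u
    using chain[OF that m(1)] m(2) that by (metis rtranclD rtrancl.rtrancl_refl)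
  then have "X \<subseteq> set xs" using xs by blast
  then have "card X \<le> length xs"
    using card_length card_mono by (metis List.finite_set le_trans)
  then show ?thesis using path_length_le_forest_depth[OF F xs(1-3)] by simp
qed simp

text \<open>Levels increase strictly along a path, so a path ending at level \<open>m\<close> has at
  most \<open>m + 1\<close> vertices. Depth bounds thus reduce to exhibiting a level
  function.\<close>

lemma forest_depth_le_level:
  assumes lev: "\<And>u v. (u, v) \<in> F \<Longrightarrow> l u < l v" and bound: "\<And>v. v \<in> V \<Longrightarrow> l v < (d::nat)"
  shows "forest_depth V F \<le> d"
proof -
  have *: "length xs \<le> Suc (l (last xs))"
    if "xs \<noteq> []" "successively (\<lambda>u v. (u, v) \<in> F) xs" for xs
    using that
  proof (induction xs rule: rev_induct)
    case (snoc x xs)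
    show ?case
    proof (cases "xs = []")
      case False
      then have "length xs \<le> Suc (l (last xs))" "l (last xs) < l x"
        using snoc lev by (auto simp: successively_append_iff)
      then show ?thesis by simp
    qed simp
  qed simp
  have "length xs \<le> d" if "root_leaf_path V F xs" for xs
  proof -
    have "last xs \<in> V" using that last_in_set unfolding root_leaf_path_def by blast
    then show ?thesis using * bound that unfolding root_leaf_path_def by (meson Suc_leI le_trans)
  qed
  then have "\<forall>x\<in>{length xs |xs. root_leaf_path V F xs}. x \<le> d" by blast
  then show ?thesis
    unfolding forest_depth_def
    \<comment> \<open>\<open>cSup_least\<close> requires a nonempty set; without root-to-leaf paths
      the supremum is 0 by convention.\<close>
    by (cases "{length xs |xs. root_leaf_path V F xs} = {}") (simp, meson cSup_least)
qed

lemma rooted_forest_level: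
  assumes F: "rooted_forest V F" and "(u, v) \<in> F"
  shows "card {x. (x, u) \<in> F\<^sup>+} < card {x. (x, v) \<in> F\<^sup>+}"
proof (rule psubset_card_mono)
  show "finite {x. (x, v) \<in> F\<^sup>+}"
    using rooted_forest_trancl_in[OF F] F
    by (auto simp: rooted_forest_def intro: finite_subset[of _ V])
  show "{x. (x, u) \<in> F\<^sup>+} \<subset> {x. (x, v) \<in> F\<^sup>+}"
    using assms(2) rooted_forest_irrefl[OF F, of u] trancl_into_trancl[of _ u F v] by auto
qed

subsection \<open>Tree decompositions from pebble forest covers\<close>

text \<open>Climbing to parents stops only at \<open>r\<close>, since \<open>F\<close> is
  well-founded. The criterion serves both the whole tree and the subtree of nodes whose bags contain
  a fixed vertex.\<close>

lemma connectedI_parent: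
  fixes G :: "('b, 'c) pre_digraph"
  assumes "wf F" and r: "r \<in> verts G"
    and par: "\<And>v. v \<in> verts G \<Longrightarrow> v \<noteq> r \<Longrightarrow> \<exists>u\<in>verts G. (u, v) \<in> F \<inter> arcs_ends G"
  shows "Digraph_Component.connected G"
proof -
  let ?R = "rtrancl_on (verts G) ((arcs_ends G)\<^sup>s)"
  have *: "(r, v) \<in> ?R" if "v \<in> verts G" for v
    using \<open>wf F\<close> that
  proof (induction v rule: wf_induct_rule)
    case (less v)
    show ?case
    proof (cases "v = r")
      case False
      then obtain u where "u \<in> verts G" "(u, v) \<in> F" "(u, v) \<in> arcs_ends G"
        using par less.prems by blast
      then have "(r, u) \<in> ?R" "(u, v) \<in> (arcs_ends G)\<^sup>s"
        using less.IH by (auto simp: symcl_def)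
      then show ?thesis using less.prems by (rule rtrancl_on_into_rtrancl_on)
    qed (use r in simp)
  qed
  have "sym ((arcs_ends G)\<^sup>s)" by (force simp: symcl_def intro: symI)
  then have "sym ?R" by (rule rtrancl_on_sym)
  then have "(u, v) \<in> ?R" if "u \<in> verts G" "v \<in> verts G" for u v
    using that * by (meson rtrancl_on_trans symD)
  then show ?thesis using r by (auto simp: connected_conv)
qed

section \<open>Arc walks and the absence of undirected cycles\<close>

lemma pawalk_verts_eq: "pcas u p v \<Longrightarrow> pawalk_verts u p = u # map snd p"
  by (induction p arbitrary: u) auto

lemma pcas_nth: "pcas u p v \<Longrightarrow> Suc i < length p \<Longrightarrow> fst (p ! Suc i) = snd (p ! i)"
proof (induction p arbitrary: u i)
  case (Cons a p)
  then show ?case by (cases i; cases p) auto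
qed simp

lemma pcas_ends: "pcas u p v \<Longrightarrow> p \<noteq> [] \<Longrightarrow> fst (p ! 0) = u \<and> snd (p ! (length p - 1)) = v"
proof (induction p arbitrary: u)
  case (Cons a p)
  then show ?case by (cases p) auto
qed simp

text \<open>On an undirected cycle, both neighbours of a deepest vertex would be its parent.\<close>

lemma undirected_tree_rooted:
  fixes F :: "'b rel"
  assumes F: "rooted_forest V F" and r: "r \<in> V"
    and par: "\<And>v. v \<in> V \<Longrightarrow> v \<noteq> r \<Longrightarrow> \<exists>u. (u, v) \<in> F"
  shows "undirected_tree \<lparr>pverts = V, parcs = F \<union> F\<inverse>\<rparr>"
proof -
  define T where "T = \<lparr>pverts = V, parcs = F \<union> F\<inverse>\<rparr>"
  have FV: "F \<subseteq> V \<times> V" and "finite V" and sv: "single_valued (F\<inverse>)"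
    using F by (auto simp: rooted_forest_def)
  then have "finite F" by (auto intro: finite_subset)
  have "(v, v) \<notin> F" for v using rooted_forest_irrefl[OF F] by blast
  then have "pair_graph T"
    using FV \<open>finite F\<close> \<open>finite V\<close>
    by unfold_locales (auto simp: T_def symmetric_def sym_def)
  moreover have "Digraph_Component.connected T"
    using rooted_forest_wf(1)[OF F]
    by (rule connectedI_parent[where r = r]) (use r par FV in \<open>force simp: T_def\<close>)+
  moreover have False if c: "pre_digraph.cycle T c" and n: "3 \<le> length c" for c
  proof -
    define n where "n = length c"
    obtain u where u: "set c \<subseteq> F \<union> F\<inverse>" "pcas u c u" "distinct (map snd c)"
      using c by (auto simp: pre_digraph.cycle_def pre_digraph.awalk_def cas_with_proj_eq
          awalk_verts_with_proj_eq pawalk_verts_eq T_def)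
    have "c \<noteq> []" using n by auto
    \<comment> \<open>The cyclic successor of a position: the arc at \<open>nxt i\<close> starts at
      the vertex where the arc at \<open>i\<close> ends.\<close>
    define nxt where "nxt i = (if Suc i = n then 0 else Suc i)" for i
    have nxt: "nxt i < n" "fst (c ! nxt i) = snd (c ! i)" if "i < n" for i
    proof -
      show "nxt i < n" using that by (auto simp: nxt_def)
      show "fst (c ! nxt i) = snd (c ! i)"
      proof (cases "Suc i = n")
        case True
        then have "length c - 1 = i" by (simp add: n_def)
        then show ?thesis using pcas_ends[OF u(2) \<open>c \<noteq> []\<close>] True by (simp add: nxt_def)
      next
        case False
        then show ?thesis using that pcas_nth[OF u(2), of i] by (simp add: nxt_def n_def)
      qed
    qed
    have "snd (c ! 0) \<in> snd ` set c" using \<open>c \<noteq> []\<close> by simp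
    then obtain z where z: "z \<in> snd ` set c" "\<And>y. (y, z) \<in> F\<inverse> \<Longrightarrow> y \<notin> snd ` set c"
      by (rule wfE_min[OF rooted_forest_wf(2)[OF F]]) auto
    then obtain i where i: "i < n" "z = snd (c ! i)" by (auto simp: in_set_conv_nth n_def)
    have max: "(snd (c ! i), snd (c ! j)) \<notin> F" if "j < n" for j
      using z(2)[of "snd (c ! j)"] that i by (auto simp: n_def)
    define h where "h = (if i = 0 then n - 1 else i - 1)"
    have h: "h < n" "nxt h = i" using i n by (auto simp: h_def nxt_def n_def)
    have arc: "(fst (c ! j), snd (c ! j)) \<in> F \<union> F\<inverse>" if "j < n" for j
      using subsetD[OF u(1) nth_mem, of j] that by (simp add: n_def)
    have "(snd (c ! h), snd (c ! i)) \<in> F"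
      using arc[OF i(1)] max[OF h(1)] nxt(2)[OF h(1)] h(2) by (simp del: prod.collapse)
    moreover have "(snd (c ! nxt i), snd (c ! i)) \<in> F"
      using arc[of "nxt i"] nxt[OF i(1)] max[of "nxt i"] by (simp del: prod.collapse)
    ultimately have "snd (c ! h) = snd (c ! nxt i)"
      using sv by (metis single_valuedD converse_iff)
    \<comment> \<open>Here length at least 3 enters: on a closed walk of length 2 the preceding and
      the following position coincide.\<close>
    moreover have "h \<noteq> nxt i" using i n by (auto simp: h_def nxt_def n_def)
    ultimately show False
      using u(3) h nxt(1)[OF i(1)] by (auto simp: distinct_conv_nth n_def)
  qed
  ultimately show ?thesis unfolding undirected_tree_def T_def by blast
qed

section \<open>The inclusion in the class of bounded treewidth\<close>

text \<open>The vertices of a bag carry distinct pebbles, so there are at most \<open>k\<close> of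
  them. The pebble condition on an edge says exactly that its upper end is still in the bag of its
  lower end. If \<open>u\<close> is in the bag of a proper descendant, it is also in the bag of that
  descendant's parent, which gives connectedness.\<close>

lemma pebble_class_subset_treewidth_class:
  "(pebble_class k q :: 'a pair_pre_digraph set) \<subseteq> treewidth_class (k - 1)"
proof
  fix G :: "'a pair_pre_digraph"
  assume "G \<in> pebble_class k q"
  then obtain F p where G: "pair_graph G" and cover: "pebble_forest_cover k G F p"
    by (auto simp: pebble_class_def)
  interpret pair_graph G by fact
  define V where "V = pverts G"
  have F: "rooted_forest V F" and p: "p \<in> V \<rightarrow> {1..k}"
    and comp: "\<And>u v. (u, v) \<in> parcs G \<Longrightarrow> (u, v) \<in> F\<^sup>* \<or> (v, u) \<in> F\<^sup>*"
    and peb: "\<And>u v w. (u, v) \<in> parcs G \<Longrightarrow> (u, v) \<in> F\<^sup>+ \<Longrightarrow> (u, w) \<in> F\<^sup>+ \<Longrightarrow> (w, v) \<in> F\<^sup>* \<Longrightarrow> p u \<noteq> p w"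
    using cover by (auto simp: pebble_forest_cover_def forest_cover_def V_def)
  have FV: "F \<subseteq> V \<times> V" and "finite V" and sv: "single_valued (F\<inverse>)"
    using F by (auto simp: rooted_forest_def)
  define bag where "bag v = {u. (u, v) \<in> F\<^sup>* \<and> (\<forall>w. (u, w) \<in> F\<^sup>+ \<and> (w, v) \<in> F\<^sup>* \<longrightarrow> p u \<noteq> p w)}" for v
  have bagV: "bag v \<subseteq> V" if "v \<in> V" for v
    using that rooted_forest_trancl_in[OF F] by (auto simp: bag_def rtrancl_eq_or_trancl)
  have "inj_on p (bag v)" for v
  proof (rule inj_onI, rule ccontr)
    fix x y assume xy: "x \<in> bag v" "y \<in> bag v" "p x = p y" "x \<noteq> y"
    then have "(x, y) \<in> F\<^sup>+ \<or> (y, x) \<in> F\<^sup>+"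
      using rooted_forest_ancestors_comparable[OF F, of x v y]
      by (auto simp: bag_def rtrancl_eq_or_trancl)
    then show False using xy by (auto simp: bag_def)
  qed
  then have card_bag: "card (bag v) \<le> k" if "v \<in> V" for v
    using card_inj_on_le[of p "bag v" "{1..k}"] p bagV[OF that] by auto
  obtain f :: "'a \<Rightarrow> nat" where f: "inj_on f V"
    using finite_imp_inj_to_nat_seg[OF \<open>finite V\<close>] by metis
  \<comment> \<open>The shift by one frees the number 0 for the additional root, which joins the
    trees of the forest and keeps the node set nonempty even if \<open>V\<close> is empty.\<close>
  define N where "N v = Suc (f v)" for v
  have N: "inj_on N V" using f by (auto simp: N_def inj_on_def)
  define W where "W = insert 0 (N ` V)"
  define E where "E = map_prod N N ` F \<union> {0} \<times> N ` {v \<in> V. \<nexists>u. (u, v) \<in> F}"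
  have E: "rooted_forest W E"
    unfolding rooted_forest_def
  proof (intro conjI)
    show "finite W" "E \<subseteq> W \<times> W" using \<open>finite V\<close> FV by (auto simp: W_def E_def)
    show "single_valued (E\<inverse>)"
      unfolding single_valued_def
    proof (intro allI impI)
      fix t a b assume ab: "(t, a) \<in> E\<inverse>" "(t, b) \<in> E\<inverse>"
      then obtain v where v: "v \<in> V" "t = N v" using FV by (auto simp: E_def)
      have E_iff: "(a, N v) \<in> E \<longleftrightarrow> (\<exists>u. (u, v) \<in> F \<and> a = N u) \<or> (\<nexists>u. (u, v) \<in> F) \<and> a = 0" for a
      proof
        assume "(a, N v) \<in> E"
        then consider u w where "(u, w) \<in> F" "a = N u" "N v = N w"
          | w where "w \<in> V" "\<nexists>u. (u, w) \<in> F" "a = 0" "N v = N w" by (auto simp: E_def)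
        then show "(\<exists>u. (u, v) \<in> F \<and> a = N u) \<or> (\<nexists>u. (u, v) \<in> F) \<and> a = 0"
        proof cases
          case 1
          then have "w = v" using FV v inj_onD[OF N] by blast
          then show ?thesis using 1 by blast
        next
          case 2
          then have "w = v" using v inj_onD[OF N] by blast
          then show ?thesis using 2 by blast
        qed
      qed (use v in \<open>auto simp: E_def\<close>)
      show "a = b"
        using ab single_valuedD[OF sv] by (auto simp: v E_iff)
    qed
    \<comment> \<open>A level function for \<open>E\<close>: the new root has level 0, and any other
      node has one more than its number of strict ancestors in \<open>F\<close>.\<close>
    define l where
      "l t = (if t = 0 then 0 else Suc (card {u. (u, the_inv_into V N t) \<in> F\<^sup>+}))" for t
    have "E \<subseteq> measure l"
    proof
      have l_N: "l (N v) = Suc (card {u. (u, v) \<in> F\<^sup>+})" if "v \<in> V" for v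
        using that the_inv_into_f_f[OF N] by (simp add: l_def N_def)
      fix e assume "e \<in> E"
      then consider u v where "(u, v) \<in> F" "e = (N u, N v)" | v where "v \<in> V" "e = (0, N v)"
        by (auto simp: E_def)
      then show "e \<in> measure l"
      proof cases
        case 1
        then have "u \<in> V" "v \<in> V" using FV by auto
        then show ?thesis using 1 rooted_forest_level[OF F] by (simp add: l_N)
      next
        case 2
        then show ?thesis by (simp add: l_N l_def[of 0])
      qed
    qed
    then show "acyclic E" by (meson wf_acyclic wf_measure wf_subset)
  qed
  define T where "T = \<lparr>pverts = W, parcs = E \<union> E\<inverse>\<rparr>"
  \<comment> \<open>As \<open>N\<close> is injective, the union has at most one term: it is the bag
    of \<open>v\<close> at \<open>N v\<close> and empty at 0.\<close>
  define B where "B t = (\<Union>v\<in>{v \<in> V. N v = t}. bag v)" for t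
  have B: "B 0 = {}" "\<And>v. v \<in> V \<Longrightarrow> B (N v) = bag v"
  proof -
    show "B 0 = {}" by (simp add: B_def N_def)
    fix v assume "v \<in> V"
    then have "{w \<in> V. N w = N v} = {v}" using inj_onD[OF N] by blast
    then show "B (N v) = bag v" by (simp add: B_def)
  qed
  have self: "v \<in> bag v" for v
    using rooted_forest_irrefl[OF F, of v] trancl_rtrancl_trancl[of v _ F v] by (auto simp: bag_def)
  have "undirected_tree T"
    unfolding T_def
  proof (rule undirected_tree_rooted[OF E])
    show "0 \<in> W" by (simp add: W_def)
    fix t assume "t \<in> W" "t \<noteq> 0"
    then obtain v where v: "v \<in> V" "t = N v" by (auto simp: W_def)
    show "\<exists>s. (s, t) \<in> E"
    proof (cases "\<exists>u. (u, v) \<in> F")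
      case True
      then show ?thesis using v by (auto simp: E_def)
    next
      case False
      then have "(0, N v) \<in> E" using v by (auto simp: E_def)
      then show ?thesis using v by blast
    qed
  qed
  moreover have "(\<Union>t\<in>W. B t) = V" using B self subsetD[OF bagV] by (auto simp: W_def)
  moreover have "\<exists>t\<in>W. u \<in> B t \<and> v \<in> B t" if uv: "(u, v) \<in> parcs G" for u v
  proof -
    have "u \<in> V" "v \<in> V" "u \<noteq> v" "(v, u) \<in> parcs G"
      using uv in_arcsD1 in_arcsD2 no_loops' arcs_symmetric by (auto simp: V_def)
    then have "(u \<in> bag v) \<or> (v \<in> bag u)"
    proof (cases "(u, v) \<in> F\<^sup>+")
      case True
      then show ?thesis using peb[OF uv True] trancl_into_rtrancl[OF True] by (simp add: bag_def)
    next
      case False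
      then have vu: "(v, u) \<in> F\<^sup>+" using comp[OF uv] \<open>u \<noteq> v\<close> by (auto simp: rtrancl_eq_or_trancl)
      then show ?thesis using peb[OF \<open>(v, u) \<in> parcs G\<close> vu] trancl_into_rtrancl[OF vu] by (simp add: bag_def)
    qed
    then show ?thesis using self B \<open>u \<in> V\<close> \<open>v \<in> V\<close> by (auto simp: W_def)
  qed
  moreover have "Digraph_Component.connected (T \<restriction> {t \<in> W. u \<in> B t})" if "u \<in> V" for u
  proof (rule connectedI_parent[OF rooted_forest_wf(1)[OF E], where r = "N u"])
    show "N u \<in> verts (T \<restriction> {t \<in> W. u \<in> B t})"
      using that self B by (simp add: W_def)
    fix t assume "t \<in> verts (T \<restriction> {t \<in> W. u \<in> B t})" and "t \<noteq> N u"
    then obtain v where v: "v \<in> V" "t = N v" "u \<in> bag v" "v \<noteq> u"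
      using B by (auto simp: W_def)
    then obtain w where w: "(u, w) \<in> F\<^sup>*" "(w, v) \<in> F"
      unfolding bag_def by (metis (mono_tags, lifting) mem_Collect_eq rtranclE)
    then have "u \<in> bag w" using v rtrancl_into_rtrancl[of _ w F v] by (auto simp: bag_def)
    moreover have "w \<in> V" using w FV by auto
    moreover have "(N w, N v) \<in> E" using w by (force simp: E_def)
    ultimately show "\<exists>s\<in>verts (T \<restriction> {t \<in> W. u \<in> B t}).
        (s, t) \<in> E \<inter> arcs_ends (T \<restriction> {t \<in> W. u \<in> B t})"
      using v B by (intro bexI[of _ "N w"]) (auto simp: W_def T_def arcs_ends_conv)
  qed
  ultimately have "tree_decomposition G T B"
    by (auto simp: tree_decomposition_def T_def V_def)
  moreover have "decomposition_width T B \<le> k - 1"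
  proof -
    have "Max ((\<lambda>t. card (B t)) ` W) \<le> k"
      using \<open>finite V\<close> card_bag B by (subst Max_le_iff) (auto simp: W_def)
    then show ?thesis by (simp add: decomposition_width_def T_def)
  qed
  ultimately show "G \<in> treewidth_class (k - 1)"
    using G by (auto simp: treewidth_class_def treewidth_le_iff)
qed

subsection \<open>Powers of paths\<close>

text \<open>Distance at most \<open>w\<close> is written as two additive bounds because subtraction
  of naturals truncates. The map \<open>g\<close> carries the graph into an arbitrary infinite
  vertex type.\<close>

definition path_power :: "(nat \<Rightarrow> 'a) \<Rightarrow> nat \<Rightarrow> nat \<Rightarrow> 'a pair_pre_digraph" where
  "path_power g w n = \<lparr>pverts = g ` {..<n},
     parcs = {(g i, g j) |i j. i < n \<and> j < n \<and> i \<noteq> j \<and> i \<le> j + w \<and> j \<le> i + w}\<rparr>"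

lemma pverts_path_power [simp]: "pverts (path_power g w n) = g ` {..<n}"
  by (simp add: path_power_def)

lemma parcs_path_power_iff:
  assumes "inj g"
  shows "(g i, g j) \<in> parcs (path_power g w n) \<longleftrightarrow>
    i < n \<and> j < n \<and> i \<noteq> j \<and> i \<le> j + w \<and> j \<le> i + w"
  using assms by (auto simp: path_power_def inj_eq)

lemma parcs_path_powerE:
  assumes "(u, v) \<in> parcs (path_power g w n)"
  obtains i j where "u = g i" "v = g j" "i < n" "j < n" "i \<noteq> j" "i \<le> j + w" "j \<le> i + w"
  using assms by (auto simp: path_power_def)

lemma pair_graph_path_power:
  assumes "inj g"
  shows "pair_graph (path_power g w n)"
proof
  show "finite (parcs (path_power g w n))"
    by (rule finite_subset[of _ "g ` {..<n} \<times> g ` {..<n}"]) (auto simp: path_power_def)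
  show "symmetric (path_power g w n)"
    by (auto simp: symmetric_def sym_def path_power_def)
qed (use assms in \<open>auto simp: path_power_def inj_eq\<close>)

text \<open>The path itself is the forest, and the pebbles are residues modulo \<open>w + 1\<close>,
  which are distinct on any \<open>w + 1\<close> consecutive vertices. Combined with the preceding
  inclusion this bounds the treewidth by \<open>w\<close>.\<close>

lemma path_power_in_pebble_class:
  assumes g: "inj g"
  shows "path_power g w n \<in> pebble_class (Suc w) n"
proof -
  let ?V = "g ` {..<n}"
  define F where "F = {(g i, g (Suc i)) |i. Suc i < n}"
  define p where "p v = Suc (the_inv g v mod Suc w)" for v
  have lev: "the_inv g u < the_inv g v" if "(u, v) \<in> F" for u v
    using that by (auto simp: F_def the_inv_f_f[OF g])
  then have "F \<subseteq> measure (the_inv g)" by auto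
  then have "acyclic F" by (meson wf_acyclic wf_measure wf_subset)
  then have F: "rooted_forest ?V F"
    using g by (auto simp: rooted_forest_def F_def single_valued_def inj_eq)
  have path: "(g i, g j) \<in> F\<^sup>*" if "i \<le> j" "j < n" for i j
    using that
  proof (induction j rule: dec_induct)
    case (step m)
    then have "(g m, g (Suc m)) \<in> F" by (auto simp: F_def)
    then show ?case using step by simp
  qed simp
  have less: "the_inv g u < the_inv g v" if "(u, v) \<in> F\<^sup>+" for u v
    using that by (induction rule: trancl_induct) (use lev less_trans in blast)+
  have "forest_cover (path_power g w n) F"
    unfolding forest_cover_def
  proof (intro conjI ballI, unfold split_paired_all prod.case)
    fix u v assume "(u, v) \<in> parcs (path_power g w n)"
    then obtain i j where "u = g i" "v = g j" "i < n" "j < n" by (rule parcs_path_powerE)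
    then show "(u, v) \<in> F\<^sup>* \<or> (v, u) \<in> F\<^sup>*" using path[of i j] path[of j i] by force
  qed (use F in simp)
  moreover have "p \<in> ?V \<rightarrow> {1..Suc w}" by (auto simp: p_def Suc_le_eq)
  moreover have "p u \<noteq> p x"
    if uv: "(u, v) \<in> parcs (path_power g w n)" and "(u, x) \<in> F\<^sup>+" "(x, v) \<in> F\<^sup>*" for u v x
  proof -
    obtain i j where ij: "u = g i" "v = g j" "j \<le> i + w" using uv by (rule parcs_path_powerE)
    have "the_inv g u < the_inv g x" "the_inv g x \<le> the_inv g v"
      using less that by (auto simp: rtrancl_eq_or_trancl less_imp_le)
    then have "i < the_inv g x" "the_inv g x - i < Suc w"
      using ij the_inv_f_f[OF g] by auto
    then have "\<not> Suc w dvd the_inv g x - i" by (auto dest: dvd_imp_le)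
    then have "the_inv g x mod Suc w \<noteq> i mod Suc w"
      using mod_eq_dvd_iff_nat[of i "the_inv g x" "Suc w"] \<open>i < the_inv g x\<close> by simp
    then show ?thesis using ij(1) the_inv_f_f[OF g] by (simp add: p_def)
  qed
  ultimately have "pebble_forest_cover (Suc w) (path_power g w n) F p"
    unfolding pebble_forest_cover_def pverts_path_power by blast
  moreover have "forest_depth ?V F \<le> n"
    by (rule forest_depth_le_level[where l = "the_inv g"])
      (use lev in \<open>auto simp: the_inv_f_f[OF g]\<close>)
  ultimately show ?thesis
    using pair_graph_path_power[OF g] unfolding pebble_class_def pverts_path_power by auto
qed

subsection \<open>Treedepth of powers of paths\<close>

text \<open>The existence of a level function below \<open>d\<close> bounds the depth of the forest by \<open>d\<close>.\<close>

definition has_forest :: "'a rel \<Rightarrow> 'a set \<Rightarrow> nat \<Rightarrow> bool" where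
  "has_forest E V d \<longleftrightarrow> (\<exists>F l. rooted_forest V F \<and>
     (\<forall>u v. (u, v) \<in> F \<longrightarrow> l u < l v) \<and> (\<forall>v\<in>V. l v < d) \<and>
     (\<forall>u\<in>V. \<forall>v\<in>V. (u, v) \<in> E \<longrightarrow> (u, v) \<in> F\<^sup>* \<or> (v, u) \<in> F\<^sup>*))"

lemma has_forest_mono: "has_forest E V d \<Longrightarrow> d \<le> d' \<Longrightarrow> has_forest E V d'"
  unfolding has_forest_def by (elim exE conjE, intro exI conjI) auto

lemma has_forest_empty: "has_forest E {} d"
  by (auto simp: has_forest_def rooted_forest_def acyclic_def intro!: exI[of _ "{}"])

lemma acyclic_level: "(\<And>u v. (u, v) \<in> F \<Longrightarrow> l u < (l v :: nat)) \<Longrightarrow> acyclic F"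
  by (rule wf_acyclic, rule wf_subset[of "measure l"]) auto

text \<open>Put \<open>x\<close> as a new root above all old roots. It becomes comparable to every
  vertex, so its edges are covered whatever they are, and all old levels shift by one.\<close>

lemma has_forest_insert:
  assumes "has_forest E V d" and x: "x \<notin> V"
  shows "has_forest E (insert x V) (Suc d)"
proof -
  obtain F l where F: "rooted_forest V F" and l: "\<And>u v. (u, v) \<in> F \<Longrightarrow> l u < l v"
    and d: "\<And>v. v \<in> V \<Longrightarrow> l v < d"
    and comp: "\<And>u v. u \<in> V \<Longrightarrow> v \<in> V \<Longrightarrow> (u, v) \<in> E \<Longrightarrow> (u, v) \<in> F\<^sup>* \<or> (v, u) \<in> F\<^sup>*"
    using assms(1) unfolding has_forest_def by blast
  have FV: "F \<subseteq> V \<times> V" and "finite V" and sv: "single_valued (F\<inverse>)"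
    using F by (auto simp: rooted_forest_def)
  define F' where "F' = F \<union> {x} \<times> {v \<in> V. \<nexists>u. (u, v) \<in> F}"
  define l' where "l' v = (if v = x then 0 else Suc (l v))" for v
  have l': "l' u < l' v" if "(u, v) \<in> F'" for u v
    using that l[of u v] x FV by (auto simp: F'_def l'_def)
  have "rooted_forest (insert x V) F'"
    unfolding rooted_forest_def
  proof (intro conjI)
    show "single_valued (F'\<inverse>)"
      using single_valuedD[OF sv] by (auto simp: F'_def single_valued_def)
    show "acyclic F'" using l' by (rule acyclic_level)
  qed (use FV \<open>finite V\<close> in \<open>auto simp: F'_def\<close>)
  moreover have root: "(x, v) \<in> F'\<^sup>*" if "v \<in> insert x V" for v
    using rooted_forest_wf(1)[OF F] that
  proof (induction v rule: wf_induct_rule)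
    case (less v)
    consider "v = x" | u where "(u, v) \<in> F" | "v \<in> V" "\<nexists>u. (u, v) \<in> F" using less.prems by blast
    then show ?case
    proof cases
      case 2
      then have "(x, u) \<in> F'\<^sup>*" using FV by (intro less.IH) auto
      moreover have "(u, v) \<in> F'" using 2 by (simp add: F'_def)
      ultimately show ?thesis by simp
    next
      case 3
      then have "(x, v) \<in> F'" by (simp add: F'_def)
      then show ?thesis by simp
    qed simp
  qed
  moreover have "F\<^sup>* \<subseteq> F'\<^sup>*" by (rule rtrancl_mono) (auto simp: F'_def)
  then have "(u, v) \<in> F'\<^sup>* \<or> (v, u) \<in> F'\<^sup>*"
    if "u \<in> insert x V" "v \<in> insert x V" "(u, v) \<in> E" for u v
    using that root comp by blast
  moreover have "l' v < Suc d" if "v \<in> insert x V" for v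
    using that d by (auto simp: l'_def)
  ultimately show ?thesis using l' unfolding has_forest_def by blast
qed

lemma has_forest_Un_card:
  assumes "finite S" "has_forest E V d" "S \<inter> V = {}"
  shows "has_forest E (S \<union> V) (d + card S)"
  using assms by (induction S rule: finite_induct) (auto intro: has_forest_insert)

text \<open>The forests are placed side by side; with no edge between \<open>A\<close> and
  \<open>B\<close>, no new pair must be comparable.\<close>

lemma has_forest_Un:
  assumes "has_forest E A d" "has_forest E B d" and disj: "A \<inter> B = {}"
    and E: "\<And>u v. u \<in> A \<Longrightarrow> v \<in> B \<Longrightarrow> (u, v) \<notin> E \<and> (v, u) \<notin> E"
  shows "has_forest E (A \<union> B) d"
proof -
  obtain F l where F: "rooted_forest A F" and l: "\<And>u v. (u, v) \<in> F \<Longrightarrow> l u < l v"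
    and d: "\<And>v. v \<in> A \<Longrightarrow> l v < d"
    and comp: "\<And>u v. u \<in> A \<Longrightarrow> v \<in> A \<Longrightarrow> (u, v) \<in> E \<Longrightarrow> (u, v) \<in> F\<^sup>* \<or> (v, u) \<in> F\<^sup>*"
    using assms(1) unfolding has_forest_def by blast
  obtain F' l' where F': "rooted_forest B F'" and l': "\<And>u v. (u, v) \<in> F' \<Longrightarrow> l' u < l' v"
    and d': "\<And>v. v \<in> B \<Longrightarrow> l' v < d"
    and comp': "\<And>u v. u \<in> B \<Longrightarrow> v \<in> B \<Longrightarrow> (u, v) \<in> E \<Longrightarrow> (u, v) \<in> F'\<^sup>* \<or> (v, u) \<in> F'\<^sup>*"
    using assms(2) unfolding has_forest_def by blast
  have FA: "F \<subseteq> A \<times> A" "F' \<subseteq> B \<times> B" and sv: "single_valued (F\<inverse>)" "single_valued (F'\<inverse>)"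
    using F F' by (auto simp: rooted_forest_def)
  define k where "k v = (if v \<in> A then l v else l' v)" for v
  have k: "k u < k v" if "(u, v) \<in> F \<union> F'" for u v
    using that l[of u v] l'[of u v] FA disj by (auto simp: k_def)
  have "rooted_forest (A \<union> B) (F \<union> F')"
    unfolding rooted_forest_def
  proof (intro conjI)
    show "single_valued ((F \<union> F')\<inverse>)"
      unfolding single_valued_def
      using single_valuedD[OF sv(1)] single_valuedD[OF sv(2)] FA disj by blast
    show "acyclic (F \<union> F')" using k by (rule acyclic_level)
  qed (use FA F F' in \<open>auto simp: rooted_forest_def\<close>)
  moreover have "F\<^sup>* \<subseteq> (F \<union> F')\<^sup>*" "F'\<^sup>* \<subseteq> (F \<union> F')\<^sup>*" by (auto intro!: rtrancl_mono)
  then have "(u, v) \<in> (F \<union> F')\<^sup>* \<or> (v, u) \<in> (F \<union> F')\<^sup>*"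
    if "u \<in> A \<union> B" "v \<in> A \<union> B" "(u, v) \<in> E" for u v
    using that E comp[of u v] comp'[of u v] by blast
  moreover have "k v < d" if "v \<in> A \<union> B" for v
    using that d d' by (auto simp: k_def)
  ultimately show ?thesis using k unfolding has_forest_def by blast
qed

text \<open>Any \<open>w\<close> consecutive positions separate the two sides. They cost
  \<open>w\<close> levels, and the admissible length \<open>L t = w * (2 ^ t - 1)\<close> satisfies
  \<open>L (t + 1) = 2 * L t + w\<close>.\<close>

lemma has_forest_path_power:
  assumes g: "inj g" and "b \<le> a + w * (2 ^ t - 1)"
  shows "has_forest (parcs (path_power g w n)) (g ` {a..<b}) (w * t)"
  using assms(2)
proof (induction t arbitrary: a b)
  case 0
  then show ?case by (simp add: has_forest_empty)
next
  case (Suc t)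
  let ?E = "parcs (path_power g w n)"
  define c where "c = a + w * (2 ^ t - 1)"
  have "w * (2 ^ Suc t - 1) = w * (2 ^ t - 1) + w + w * (2 ^ t - 1)"
    by (cases "2 ^ t :: nat") (auto simp: algebra_simps)
  then have b: "b \<le> c + w + w * (2 ^ t - 1)" using Suc.prems by (simp add: c_def)
  show ?case
  proof (cases "b \<le> c")
    case True
    then have "has_forest ?E (g ` {a..<b}) (w * t)" by (intro Suc.IH) (simp add: c_def)
    then show ?thesis by (rule has_forest_mono) simp
  next
    case False
    \<comment> \<open>The left block has the full length allowed for \<open>t\<close>. The
      \<open>min\<close> cuts the separator off if the interval ends inside it, and then the right
      block is empty.\<close>
    let ?S = "g ` {c..<min (c + w) b}" and ?V = "g ` {a..<c} \<union> g ` {c + w..<b}"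
    have "has_forest ?E ?V (w * t)"
    proof (rule has_forest_Un)
      show "has_forest ?E (g ` {a..<c}) (w * t)" "has_forest ?E (g ` {c + w..<b}) (w * t)"
        using b by (auto intro!: Suc.IH simp: c_def)
    qed (use g in \<open>auto simp: parcs_path_power_iff inj_eq\<close>)
    then have "has_forest ?E (?S \<union> ?V) (w * t + card ?S)"
      by (rule has_forest_Un_card[rotated]) (use g in \<open>auto simp: inj_eq\<close>)
    moreover have "?S \<union> ?V = g ` {a..<b}"
    proof -
      have "{a..<b} = {c..<min (c + w) b} \<union> ({a..<c} \<union> {c + w..<b})"
        using False by (auto simp: c_def)
      then show ?thesis by (simp only: image_Un)
    qed
    moreover have "card ?S \<le> w"
      using card_image_le[of "{c..<min (c + w) b}" g] by simp
    ultimately show ?thesis by (auto elim: has_forest_mono)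
  qed
qed

lemma has_forest_imp_treedepth_class:
  assumes G: "pair_graph G" and "has_forest (parcs G) (pverts G) d"
  shows "G \<in> treedepth_class d"
proof -
  interpret pair_graph G by fact
  obtain F l where F: "rooted_forest (pverts G) F" and l: "\<And>u v. (u, v) \<in> F \<Longrightarrow> l u < l v"
    and d: "\<And>v. v \<in> pverts G \<Longrightarrow> l v < d"
    and comp: "\<And>u v. u \<in> pverts G \<Longrightarrow> v \<in> pverts G \<Longrightarrow>
      (u, v) \<in> parcs G \<Longrightarrow> (u, v) \<in> F\<^sup>* \<or> (v, u) \<in> F\<^sup>*"
    using assms(2) unfolding has_forest_def by blast
  have "forest_depth (pverts G) F \<le> d" using l d by (rule forest_depth_le_level)
  moreover have "forest_cover G F"
    using F comp in_arcsD1 in_arcsD2 unfolding forest_cover_def by blast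
  ultimately show ?thesis
    using G by (auto simp: treedepth_class_def treedepth_le_iff)
qed

lemma path_power_in_treedepth_class:
  assumes g: "inj g" and "n \<le> w * (2 ^ t - 1)"
  shows "path_power g w n \<in> treedepth_class (w * t)"
proof (rule has_forest_imp_treedepth_class[OF pair_graph_path_power[OF g]])
  show "has_forest (parcs (path_power g w n)) (pverts (path_power g w n)) (w * t)"
    using has_forest_path_power[OF g, of n 0 w t n] assms(2) by (simp add: atLeast0LessThan)
qed

subsection \<open>Pebble forest covers of powers of paths are deep\<close>

text \<open>
  The dichotomy makes the order unimodal along the path: it descends up to some \<open>a\<close> and ascends
  from there, so that \<open>{a..<n}\<close> and \<open>{..<a + w}\<close> are chains.
\<close>

lemma unimodal_chain_bound:
  fixes lt :: "nat \<Rightarrow> nat \<Rightarrow> bool"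
  assumes trans: "\<And>i j k. lt i j \<Longrightarrow> lt j k \<Longrightarrow> lt i k" and irrefl: "\<And>i. \<not> lt i i"
    and edge: "\<And>i j. i < j \<Longrightarrow> j \<le> i + w \<Longrightarrow> j < n \<Longrightarrow> lt i j \<or> lt j i"
    and dichotomy: "\<And>i. i + w + 1 < n \<Longrightarrow> (\<forall>j. i < j \<and> j \<le> i + w \<longrightarrow> lt j i) \<or>
      (\<forall>j. i < j \<and> j \<le> i + w \<longrightarrow> lt j (i + w + 1))"
    and card_chain: "\<And>X. X \<subseteq> {..<n} \<Longrightarrow>
      (\<And>i j. i \<in> X \<Longrightarrow> j \<in> X \<Longrightarrow> i < j \<Longrightarrow> lt i j \<or> lt j i) \<Longrightarrow> card X \<le> q"
    and w: "1 \<le> w" and q: "1 \<le> q"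
  shows "n < 2 * q"
proof -
  \<comment> \<open>\<open>D i\<close> says that a descent starts at \<open>i\<close>: the next
    \<open>w\<close> positions exist and all precede \<open>i\<close> in the order.\<close>
  define D where "D i \<longleftrightarrow> i + w < n \<and> (\<forall>j. i < j \<and> j \<le> i + w \<longrightarrow> lt j i)" for i
  have dich: "D i \<or> (\<forall>j. i < j \<and> j \<le> i + w \<longrightarrow> lt j (i + w + 1))" if "i + w + 1 < n" for i
    using dichotomy[OF that] that by (auto simp: D_def)
  have "\<not> D n" by (simp add: D_def)
  define a where "a = (LEAST i. \<not> D i)"
  have a: "\<not> D a" using \<open>\<not> D n\<close> unfolding a_def by (rule LeastI)
  have D: "D i" if "i < a" for i using not_less_Least[of i "\<lambda>i. \<not> D i"] that by (auto simp: a_def)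
  \<comment> \<open>The descents at \<open>i\<close>, ..., \<open>a - 1\<close> are chained by
    transitivity; the last one reaches up to \<open>a - 1 + w\<close>.\<close>
  have left: "lt j i" if "i < a" "i < j" "j < a + w" for i j
    using that
  proof (induction "a - i" arbitrary: i)
    case (Suc d)
    show ?case
    proof (cases "j \<le> i + w")
      case True
      then show ?thesis using D[of i] Suc.prems by (simp add: D_def)
    next
      case False
      then have "lt j (Suc i)" using Suc w by (intro Suc.hyps(1)) auto
      moreover have "lt (Suc i) i" using D[of i] Suc.prems w by (simp add: D_def)
      ultimately show ?thesis using trans by blast
    qed
  qed simp
  have "a + w \<le> n \<or> a = 0"
    using D[of "a - 1"] by (cases a) (auto simp: D_def)
  show ?thesis
  proof (cases "a + w < n")
    case True
    have right: "\<forall>i. a \<le> i \<and> i < j \<longrightarrow> lt i j" if "a + w < j" "j < n" for j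
      using that
    proof (induction j)
      case (Suc j)
      show ?case
      proof (cases "a + w < j")
        case True
        then have j: "j - w + w + 1 = Suc j" "a \<le> j - w" "j - w < j" using w by auto
        \<comment> \<open>\<open>D (j - w)\<close> would put \<open>j\<close> before
          \<open>j - w\<close>, against the induction hypothesis. So the other alternative of
          \<open>dich\<close> holds and yields \<open>lt j (Suc j)\<close>.\<close>
        have IH: "\<forall>i. a \<le> i \<and> i < j \<longrightarrow> lt i j" using Suc True by simp
        then have "\<not> lt j (j - w)" using j irrefl trans by blast
        moreover have "j \<le> (j - w) + w" by simp
        ultimately have "\<not> D (j - w)" using j(3) unfolding D_def by blast
        then have "lt j (Suc j)" using dich[of "j - w"] j Suc.prems by auto
        then show ?thesis using IH trans less_Suc_eq by metis
      next
        case False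
        then have j: "j = a + w" using Suc.prems by simp
        have up: "lt i (Suc j)" if "a < i" "i \<le> j" for i
          using dich[of a] a that Suc.prems j by simp
        \<comment> \<open>This treats \<open>a\<close> itself, which \<open>up\<close> leaves out:
          as \<open>D a\<close> fails, \<open>a\<close> precedes some \<open>x\<close> of its
          window, and \<open>x\<close> precedes \<open>Suc j\<close>.\<close>
        obtain x where x: "a < x" "x \<le> a + w" "\<not> lt x a"
          using a \<open>a + w < n\<close> by (auto simp: D_def)
        then have "lt a x" using edge[of a x] \<open>a + w < n\<close> by auto
        then have "lt a (Suc j)" using up[of x] x j trans by blast
        then show ?thesis using up \<open>lt a (Suc j)\<close> by (metis le_neq_implies_less less_Suc_eq_le)
      qed
    qed simp
    have "card {a..<n} \<le> q"
    proof (rule card_chain)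
      fix i j assume "i \<in> {a..<n}" "j \<in> {a..<n}" "i < j"
      then show "lt i j \<or> lt j i"
        using right[of j] edge[of i j] by (cases "a + w < j") auto
    qed auto
    moreover have "card {..<a + w} \<le> q"
    proof (rule card_chain)
      fix i j assume "i \<in> {..<a + w}" "j \<in> {..<a + w}" "i < j"
      then show "lt i j \<or> lt j i"
        using left[of i j] edge[of i j] True by (cases "i < a") auto
    qed (use True in auto)
    \<comment> \<open>The two chains cover the path and overlap in \<open>w\<close> positions, so
      \<open>n + w \<le> 2 * q\<close>.\<close>
    ultimately show ?thesis using w True by simp
  next
    case False
    \<comment> \<open>The whole path is one chain: pairs starting before \<open>a\<close> are
      comparable by the descent, all others are within distance \<open>w\<close>.\<close>
    have "card {..<n} \<le> q"
    proof (rule card_chain)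
      fix i j assume "i \<in> {..<n}" "j \<in> {..<n}" "i < j"
      then show "lt i j \<or> lt j i"
        using left[of i j] edge[of i j] False \<open>a + w \<le> n \<or> a = 0\<close> by (cases "i < a") auto
    qed simp
    then show ?thesis using q by simp
  qed
qed

text \<open>The strict ancestor order, read on positions, satisfies the hypotheses of
  \<open>unimodal_chain_bound\<close>. The pebbles enter through the dichotomy, the depth through
  the bound on chains.\<close>

lemma path_power_notin_pebble_class:
  fixes g :: "nat \<Rightarrow> 'a"
  assumes g: "inj g" and w: "1 \<le> w" and q: "1 \<le> q" and n: "2 * q \<le> n"
  shows "path_power g w n \<notin> pebble_class (Suc w) q"
proof
  assume "path_power g w n \<in> pebble_class (Suc w) q"
  then obtain F p where cover: "pebble_forest_cover (Suc w) (path_power g w n) F p"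
    and depth: "forest_depth (g ` {..<n}) F \<le> q"
    unfolding pebble_class_def by auto
  have F: "rooted_forest (g ` {..<n}) F"
    using cover by (simp add: pebble_forest_cover_def forest_cover_def)
  define lt where "lt i j \<longleftrightarrow> (g i, g j) \<in> F\<^sup>+" for i j
  have trans: "lt i k" if "lt i j" "lt j k" for i j k
    using that by (auto simp: lt_def)
  have irrefl: "\<not> lt i i" for i
    using rooted_forest_irrefl[OF F] by (simp add: lt_def)
  have edge: "lt i j \<or> lt j i" if "i < j" "j \<le> i + w" "j < n" for i j
  proof -
    have "(g i, g j) \<in> parcs (path_power g w n)" "g i \<noteq> g j"
      using that g by (auto simp: parcs_path_power_iff inj_eq)
    then show ?thesis
      using cover by (auto simp: pebble_forest_cover_def forest_cover_def lt_def rtrancl_eq_or_trancl)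
  qed
  have edge': "lt i j \<or> lt j i" if "i \<noteq> j" "j \<le> i + w" "i \<le> j + w" "i < n" "j < n" for i j
    using edge[of i j] edge[of j i] that by linarith
  have chain: "lt i j \<or> lt j i" if "i = m \<or> lt i m" "j = m \<or> lt j m" "i \<noteq> j" for i j m
  proof -
    have "(g i, g m) \<in> F\<^sup>*" "(g j, g m) \<in> F\<^sup>*" "g i \<noteq> g j"
      using that g by (auto simp: lt_def inj_eq)
    then show ?thesis
      using rooted_forest_ancestors_comparable[OF F, of "g i" "g m" "g j"]
      unfolding lt_def by (metis rtranclD)
  qed
  have pebble: "p (g i) \<noteq> p (g j)"
    if "lt i j" "j = m \<or> lt j m" "i \<le> m + w" "m \<le> i + w" "i < n" "m < n" for i j m
  proof -
    have "lt i m" using that trans by blast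
    then have "i \<noteq> m" using irrefl by blast
    then have "(g i, g m) \<in> parcs (path_power g w n)" using that g by (simp add: parcs_path_power_iff)
    moreover have "(g j, g m) \<in> F\<^sup>*" using that(2) by (auto simp: lt_def)
    ultimately show ?thesis
      using cover \<open>lt i m\<close> \<open>lt i j\<close> by (auto simp: pebble_forest_cover_def lt_def)
  qed
  have card_chain: "card X \<le> q"
    if X: "X \<subseteq> {..<n}" and "\<And>i j. i \<in> X \<Longrightarrow> j \<in> X \<Longrightarrow> i < j \<Longrightarrow> lt i j \<or> lt j i" for X
  proof -
    have "(g i, g j) \<in> F\<^sup>* \<or> (g j, g i) \<in> F\<^sup>*" if "i \<in> X" "j \<in> X" for i j
      using that(1,2) \<open>\<And>i j. i \<in> X \<Longrightarrow> j \<in> X \<Longrightarrow> i < j \<Longrightarrow> lt i j \<or> lt j i\<close>[of i j]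
        \<open>\<And>i j. i \<in> X \<Longrightarrow> j \<in> X \<Longrightarrow> i < j \<Longrightarrow> lt i j \<or> lt j i\<close>[of j i]
      unfolding lt_def by (metis linorder_cases rtrancl.rtrancl_refl trancl_into_rtrancl)
    then have "card (g ` X) \<le> forest_depth (g ` {..<n}) F"
      by (intro card_chain_le_forest_depth[OF F]) (use X in auto)
    moreover have "card (g ` X) = card X" using g by (intro card_image) (auto intro: inj_on_subset)
    ultimately show ?thesis using depth by simp
  qed
  \<comment> \<open>The deepest vertex strictly between \<open>i\<close> and \<open>i + w + 1\<close> cannot lie below both of them:
    otherwise the \<open>w + 2\<close> vertices would need distinct pebbles.\<close>
  have dichotomy: "(\<forall>j. i < j \<and> j \<le> i + w \<longrightarrow> lt j i) \<or>
      (\<forall>j. i < j \<and> j \<le> i + w \<longrightarrow> lt j (i + w + 1))" if i: "i + w + 1 < n" for i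
  proof -
    have "g (Suc i) \<in> g ` {i<..i + w}" using w by auto
    moreover have "wf ((F\<^sup>+)\<inverse>)" using rooted_forest_wf(2)[OF F] wf_trancl by (metis trancl_converse)
    ultimately obtain z where z: "z \<in> g ` {i<..i + w}" "\<And>y. (y, z) \<in> (F\<^sup>+)\<inverse> \<Longrightarrow> y \<notin> g ` {i<..i + w}"
      by (metis wfE_min)
    then obtain m where m: "i < m" "m \<le> i + w" "z = g m" by auto
    then have "\<not> lt m j" if "i < j" "j \<le> i + w" for j
      using z(2)[of "g j"] that by (auto simp: lt_def)
    then have top: "j = m \<or> lt j m" if "i < j" "j \<le> i + w" for j
      using edge'[of j m] that m i by force
    \<comment> \<open>Position \<open>m\<close> is within distance \<open>w\<close> of both
      \<open>i\<close> and \<open>i + w + 1\<close>, hence comparable to both.\<close>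
    consider "lt m i" | "lt m (i + w + 1)" | "lt i m" "lt (i + w + 1) m"
      using edge'[of m i] edge'[of m "i + w + 1"] m i by force
    then show ?thesis
    proof cases
      case 1
      then show ?thesis using top trans by blast
    next
      case 2
      then show ?thesis using top trans by blast
    next
      case 3
      have below: "j = m \<or> lt j m" if "j \<in> {i..i + w + 1}" for j
      proof -
        have "j = i \<or> j = i + w + 1 \<or> i < j \<and> j \<le> i + w" using that by auto
        then show ?thesis using top 3 by blast
      qed
      \<comment> \<open>Any two of these positions are comparable, being at or above
        \<open>m\<close>; the edge from the upper one to \<open>m\<close> forbids its pebble at the
        lower one.\<close>
      have "inj_on (\<lambda>j. p (g j)) {i..i + w + 1}"
      proof (rule inj_onI, rule ccontr)
        fix x y assume xy: "x \<in> {i..i + w + 1}" "y \<in> {i..i + w + 1}" "p (g x) = p (g y)" "x \<noteq> y"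
        then have "lt x y \<or> lt y x" using chain below by metis
        moreover have "x \<le> m + w" "m \<le> x + w" "x < n" "y \<le> m + w" "m \<le> y + w" "y < n" "m < n"
          using xy m i by auto
        ultimately show False using pebble[of x y m] pebble[of y x m] below xy by metis
      qed
      moreover have "(\<lambda>j. p (g j)) ` {i..i + w + 1} \<subseteq> {1..Suc w}"
        using cover i unfolding pebble_forest_cover_def pverts_path_power by fastforce
      ultimately have "card {i..i + w + 1} \<le> card {1..Suc w}" by (rule card_inj_on_le) simp
      then show ?thesis by simp
    qed
  qed
  have "n < 2 * q"
    by (rule unimodal_chain_bound[of lt w n q]) (fact trans irrefl edge dichotomy card_chain w q)+
  then show False using n by simp
qed

section \<open>Strictness of the inclusions\<close>

lemma pebble_class_subset_treedepth_class:
  "(pebble_class k q :: 'a pair_pre_digraph set) \<subseteq> treedepth_class q"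
  by (auto simp: pebble_class_def treedepth_class_def treedepth_le_iff pebble_forest_cover_def)

text \<open>The number \<open>t\<close> of rounds of separation stays free: it must be small enough
  for treedepth \<open>q\<close> and large enough to exhaust the \<open>2 * q\<close> vertices of
  the witness.\<close>

lemma pebble_class_psubset:
  assumes inf: "infinite (UNIV :: 'a set)" and "1 \<le> w" "1 \<le> q" "w * t \<le> q" "2 * q \<le> w * (2 ^ t - 1)"
  shows "(pebble_class (Suc w) q :: 'a pair_pre_digraph set) \<subset> treewidth_class w \<inter> treedepth_class q"
proof -
  obtain g :: "nat \<Rightarrow> 'a" where g: "inj g"
    using infinite_countable_subset[OF inf] by blast
  let ?G = "path_power g w (2 * q)"
  have "?G \<in> treewidth_class w"
    using path_power_in_pebble_class[OF g] pebble_class_subset_treewidth_class[of "Suc w"] by auto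
  moreover have "?G \<in> treedepth_class q"
    using path_power_in_treedepth_class[OF g assms(5)] assms(4) by (auto simp: treedepth_class_def)
  moreover have "?G \<notin> pebble_class (Suc w) q"
    using assms by (intro path_power_notin_pebble_class g) auto
  ultimately show ?thesis
    using pebble_class_subset_treewidth_class[of "Suc w" q] pebble_class_subset_treedepth_class by auto
qed

theorem theorem4p28:
  assumes "infinite (UNIV :: 'a set)"
  shows "(\<forall>q::nat. 3 \<le> q \<longrightarrow>
            (pebble_class 2 q :: 'a pair_pre_digraph set) \<subset> treewidth_class 1 \<inter> treedepth_class q) \<and>
         (\<forall>k q :: nat. 1 \<le> k \<and> 1 \<le> q \<and>
            2 \<le> real k - 1 \<and> real k - 1 \<le> (real q - 4) / (1 + log 2 (real q)) \<longrightarrow>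
            (pebble_class k q :: 'a pair_pre_digraph set) \<subset> treewidth_class (k - 1) \<inter> treedepth_class q)"
proof (intro conjI allI impI)
  fix q :: nat assume q: "3 \<le> q"
  \<comment> \<open>With \<open>w = 1\<close> and \<open>t = q\<close> the length condition becomes
    \<open>2 * q \<le> 2 ^ q - 1\<close>, which holds from \<open>q = 3\<close> on.\<close>
  have "2 * q < 2 ^ q" using q by (induction q rule: dec_induct) auto
  then show "(pebble_class 2 q :: 'a pair_pre_digraph set) \<subset> treewidth_class 1 \<inter> treedepth_class q"
    using pebble_class_psubset[OF assms, of 1 q q] q by (simp add: numeral_2_eq_2)
next
  fix k q :: nat
  assume *: "1 \<le> k \<and> 1 \<le> q \<and>
    2 \<le> real k - 1 \<and> real k - 1 \<le> (real q - 4) / (1 + log 2 (real q))"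
  define w where "w = k - 1"
  \<comment> \<open>The least integer above the logarithm of \<open>q\<close>. Thus
    \<open>q \<le> 2 ^ t - 1\<close>, and \<open>2 \<le> w\<close> supplies the factor 2, while
    \<open>t\<close> is at most \<open>1 + log 2 q\<close>, the denominator in the
    assumption.\<close>
  define t where "t = Suc (nat \<lfloor>log 2 (real q)\<rfloor>)"
  have w: "2 \<le> w" "k = Suc w" "real w = real k - 1" using * by (auto simp: w_def)
  have log: "0 \<le> log 2 (real q)" using * by simp
  then have t: "real t \<le> 1 + log 2 (real q)" "log 2 (real q) < real t"
    unfolding t_def by linarith+
  have "real q = 2 powr log 2 (real q)" using * by simp
  also have "\<dots> < 2 powr real t" using t(2) by simp
  also have "\<dots> = real (2 ^ t)" by (simp add: powr_realpow)
  finally have "q < 2 ^ t" by linarith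
  then have "2 * q \<le> w * (2 ^ t - 1)" using w(1) by (intro mult_le_mono) auto
  moreover have "w * t \<le> q"
  proof -
    have "real w * real t \<le> real w * (1 + log 2 (real q))" using t(1) by (intro mult_left_mono) auto
    also have "\<dots> \<le> real q - 4" using * log w(3) by (simp add: pos_le_divide_eq)
    finally have "real (w * t) \<le> real q" by simp
    then show ?thesis by linarith
  qed
  moreover have "1 \<le> w" "1 \<le> q" using w(1) * by auto
  ultimately show "(pebble_class k q :: 'a pair_pre_digraph set) \<subset>
      treewidth_class (k - 1) \<inter> treedepth_class q"
    unfolding w(2) diff_Suc_1 by (intro pebble_class_psubset[OF assms])
qed

end
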